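(* Let $0<p<1$ and $0<\varepsilon<u_\star:=(1-p)^{1-p}/(2-p)^{2-p}$. Define \[ z(\varepsilon):=1-\sum_{n=1}^\infty\frac{\varepsilon^n}{n!}\,\frac{\Gamma\big(n(2-p)-1\big)}{\Gamma\big(n(1-p)\big)}. \] Then for any $\gamma\in\big(\tfrac1{2-p},1\big)$, \[ z(\varepsilon)=1-\frac1{2\pi i}\int_{\gamma-i\infty}^{\gamma+i\infty}\Gamma(-s)\,\frac{\Gamma\big(s(2-p)-1\big)}{\Gamma\big(s(1-p)\big)}\,(-\varepsilon)^s\,ds, \] where $(-\varepsilon)^s:=\exp\bigl(s(\log\varepsilon+i\pi)\bigr)$ denotes the upper boundary value on the negative real axis.
   Context: The integral is taken along the vertical line $\Re s=\gamma$, oriented upward. *)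

theory Defs
  imports "HOL-Complex_Analysis.Complex_Analysis"
begin

definition u_star :: "real \<Rightarrow> real" where
  "u_star p = (1 - p) powr (1 - p) / (2 - p) powr (2 - p)"

definition z_term :: "real \<Rightarrow> real \<Rightarrow> nat \<Rightarrow> real" where
  "z_term p \<epsilon> n = \<epsilon> ^ n / fact n * (Gamma (real n * (2 - p) - 1) / Gamma (real n * (1 - p)))"

(* The series starts at n = 1, hence the index shift. *)
definition z :: "real \<Rightarrow> real \<Rightarrow> real" where
  "z p \<epsilon> = 1 - (\<Sum>n. z_term p \<epsilon> (Suc n))"

(* (-\<epsilon>)^s as the boundary value from the upper half-plane: arg (-\<epsilon>) = pi. *)
definition neg_cpow :: "real \<Rightarrow> complex \<Rightarrow> complex" where
  "neg_cpow \<epsilon> s = exp (s * (complex_of_real (ln \<epsilon>) + \<i> * complex_of_real pi))"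

definition mb_integrand :: "real \<Rightarrow> real \<Rightarrow> complex \<Rightarrow> complex" where
  "mb_integrand p \<epsilon> s =
     Gamma (- s) * (Gamma (s * (2 - complex_of_real p) - 1) / Gamma (s * (1 - complex_of_real p)))
       * neg_cpow \<epsilon> s"

(* The line Re s = \<gamma>, oriented upward, is parametrised by s = \<gamma> + i t, so ds = i dt;
   the integral over t is an absolutely convergent (Lebesgue) one. *)
definition vertical_integrable :: "(complex \<Rightarrow> complex) \<Rightarrow> real \<Rightarrow> bool" where
  "vertical_integrable f \<gamma> \<longleftrightarrow> integrable lborel (\<lambda>t. f (Complex \<gamma> t) * \<i>)"

definition vertical_integral :: "(complex \<Rightarrow> complex) \<Rightarrow> real \<Rightarrow> complex" where
  "vertical_integral f \<gamma> = (\<integral>t. f (Complex \<gamma> t) * \<i> \<partial>lborel)"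

end

theory Submission
  imports Defs "HOL-Real_Asymp.Real_Asymp"
begin

text \<open>
  The reflection formula turns \<open>\<Gamma>(-s)\<close> into \<open>-\<pi> / (\<Gamma>(s + 1) sin \<pi>s)\<close>, so the
  integrand is \<open>-\<pi> H(s) (-\<epsilon>)\<^sup>s / sin \<pi>s\<close>, where
  \<open>H(s) = \<Gamma>(s(2-p) - 1) / (\<Gamma>(s + 1) \<Gamma>(s(1-p)))\<close> interpolates the coefficients of the power
  series. To the right of the abscissa \<open>1/(2-p)\<close> the only poles of the integrand are the simple ones at \<open>n = 1, 2, ...\<close>,
  and the residue there is minus the \<open>n\<close>-th term of the series. The theorem follows by closing the
  contour to the right along growing rectangles.

  What makes this work is one estimate, \<open>mb_coeff_bound\<close>. In \<open>H\<close> the arguments of the three Gamma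
  functions are, up to shifts by one, \<open>s(2-p)\<close>, \<open>s\<close> and \<open>s(1-p)\<close>, and the first is the sum of the other
  two. In Stirling's formula the factors \<open>s\<^sup>s\<close> therefore cancel and leave the pure exponential
  \<open>exp (- s ln u_star)\<close> times a factor of order \<open>|s| powr (-3/2)\<close>: thus \<open>|H(s)| \<le> C u_star powr (- Re s) |s| powr (-3/2)\<close>
  uniformly in \<open>Re s \<ge> \<gamma>\<close>, with no loss in the imaginary direction. For \<open>\<epsilon> \<le> u_star\<close> the power
  \<open>|(-\<epsilon>)\<^sup>s| = \<epsilon> powr (Re s) exp (-\<pi> Im s)\<close> absorbs \<open>u_star powr (- Re s)\<close>, and its factor
  \<open>exp (-\<pi> Im s)\<close>, which grows in the lower half-plane, is exactly compensated by \<open>1 / sin \<pi>s\<close>. Away from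
  the poles the integrand is thus \<open>O(|s| powr (-3/2))\<close>. This gives at once the absolute convergence of
  the series and of the integral, and shows that on rectangles with sides of length \<open>O(N)\<close> the three sides other
  than the one on the line \<open>Re s = \<gamma>\<close> contribute \<open>O(N powr (-1/2))\<close>.

  The uniform two-sided form of Stirling's formula that is needed, up to a constant factor and on a half-plane
  \<open>Re s \<ge> \<delta> > 0\<close>, is proved from Gudermann's series for the logarithm of the quotient of \<open>\<Gamma>(s)\<close> and its
  Stirling approximation.
\<close>

section \<open>Stirling's approximation on a half-plane, up to constants\<close>

text \<open>The customary factor \<open>sqrt (2 * pi)\<close> is left out, since only the order of magnitude matters.\<close>
definition stirling :: "complex \<Rightarrow> complex" where
  "stirling s = exp ((s - 1 / 2) * Ln s - s)"

text \<open>The general term of Gudermann's series: the logarithm of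
  \<open>stirling (s + 1) / (s * stirling s)\<close>, which measures by how much the approximation fails to
  satisfy the functional equation of the Gamma function.\<close>
definition gudermann :: "complex \<Rightarrow> complex" where
  "gudermann s = (s + 1 / 2) * (Ln (s + 1) - Ln s) - 1"

text \<open>Formally \<open>gudermann s\<close> is half the integral of \<open>(w - w\<^sup>2) / (s + w)\<^sup>2\<close> over \<open>w\<close> in \<open>[0, 1]\<close>, after
  one integration by parts; the proof applies the mean value inequality to an antiderivative.
  The quadratic decay makes the sum of \<open>gudermann (s + k)\<close> over \<open>k\<close> converge uniformly.\<close>
lemma norm_gudermann_le:
  assumes "Re s > 0"
  shows "norm (gudermann s) \<le> 1 / norm s ^ 2"
proof -
  define B where "B w = (2 * s + 1) * Ln (s + w) - 2 * w - (w - w\<^sup>2) / (s + w)" for w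
  define B' where "B' w = (w - w\<^sup>2) / (s + w)\<^sup>2" for w
  have seg: "\<exists>u. w = of_real u \<and> 0 \<le> u \<and> u \<le> 1" if "w \<in> closed_segment 0 1" for w :: complex
    using that by (auto simp: closed_segment_def scaleR_conv_of_real)
  have "norm (B 1 - B 0) \<le> (1 / norm s ^ 2) * norm (1 - 0 :: complex)"
  proof (rule field_differentiable_bound)
    fix w :: complex assume "w \<in> closed_segment 0 1"
    then obtain u where u: "w = of_real u" "0 \<le> u" "u \<le> 1" using seg by blast
    have nn: "s + w \<notin> \<real>\<^sub>\<le>\<^sub>0" "s + w \<noteq> 0"
      using assms u by (auto simp: complex_nonpos_Reals_iff complex_eq_iff)
    have "(B has_field_derivative
        (2 * s + 1) / (s + w) - 2 - ((1 - 2 * w) * (s + w) - (w - w\<^sup>2)) / (s + w)\<^sup>2) (at w)"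
      unfolding B_def using nn
      by (auto intro!: derivative_eq_intros simp: power2_eq_square inverse_eq_divide)
    also have "(2 * s + 1) / (s + w) - 2 - ((1 - 2 * w) * (s + w) - (w - w\<^sup>2)) / (s + w)\<^sup>2 = B' w"
    proof -
      have "(2 * s + 1) / (s + w) = (2 * s + 1) * (s + w) / (s + w)\<^sup>2"
        "2 = 2 * (s + w)\<^sup>2 / (s + w)\<^sup>2"
        using nn by (simp_all add: power2_eq_square)
      then have "(2 * s + 1) / (s + w) - 2 - ((1 - 2 * w) * (s + w) - (w - w\<^sup>2)) / (s + w)\<^sup>2
        = ((2 * s + 1) * (s + w) - 2 * (s + w)\<^sup>2 - ((1 - 2 * w) * (s + w) - (w - w\<^sup>2))) / (s + w)\<^sup>2"
        by (simp only: diff_divide_distrib)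
      also have "(2 * s + 1) * (s + w) - 2 * (s + w)\<^sup>2 - ((1 - 2 * w) * (s + w) - (w - w\<^sup>2)) = w - w\<^sup>2"
        by (simp add: power2_eq_square algebra_simps)
      finally show ?thesis by (simp add: B'_def)
    qed
    finally show "(B has_field_derivative B' w) (at w within closed_segment 0 1)"
      using has_field_derivative_at_within by blast
    have "norm (w - w\<^sup>2) = u * (1 - u)"
    proof -
      have "w - w\<^sup>2 = of_real (u * (1 - u))" using u by (simp add: power2_eq_square algebra_simps)
      then show ?thesis using u by (simp only: norm_of_real) simp
    qed
    also have "\<dots> \<le> 1 * 1" using u by (intro mult_mono) auto
    finally have n1: "norm (w - w\<^sup>2) \<le> 1" by simp
    have "norm s \<le> norm (s + w)"
      unfolding norm_le_square cmod_def using assms u by (intro real_sqrt_le_mono) (auto intro!: power_mono)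
    then have n2: "norm s ^ 2 \<le> norm (s + w) ^ 2" by (intro power_mono) auto
    have "norm (B' w) = norm (w - w\<^sup>2) / norm (s + w) ^ 2"
      by (simp add: B'_def norm_divide norm_power)
    also have "\<dots> \<le> 1 / norm s ^ 2"
      using n1 n2 assms by (intro frac_le) auto
    finally show "norm (B' w) \<le> 1 / norm s ^ 2" .
  qed auto
  moreover have "B 1 - B 0 = 2 * gudermann s"
    by (simp add: B_def gudermann_def algebra_simps)
  ultimately have "2 * norm (gudermann s) \<le> 1 / norm s ^ 2"
    by (simp add: norm_mult)
  then show ?thesis by (smt (verit) norm_ge_zero)
qed

lemma stirling_plus1:
  assumes "s \<noteq> 0"
  shows "stirling (s + 1) = s * stirling s * exp (gudermann s)"
proof -
  have "s * stirling s * exp (gudermann s) = exp (Ln s + ((s - 1 / 2) * Ln s - s) + gudermann s)"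
    using assms by (simp add: stirling_def exp_add exp_diff)
  also have "Ln s + ((s - 1 / 2) * Ln s - s) + gudermann s = (s + 1 - 1 / 2) * Ln (s + 1) - (s + 1)"
    by (simp add: gudermann_def algebra_simps)
  finally show ?thesis by (simp add: stirling_def)
qed

lemma stirling_plus_of_nat:
  assumes "Re s > 0"
  shows "stirling (s + of_nat n) = pochhammer s n * stirling s * exp (\<Sum>k<n. gudermann (s + of_nat k))"
proof (induction n)
  case (Suc n)
  have "s + of_nat n \<noteq> 0" using assms by (auto simp: complex_eq_iff)
  then have "stirling (s + of_nat n + 1) = (s + of_nat n) * stirling (s + of_nat n) * exp (gudermann (s + of_nat n))"
    by (rule stirling_plus1)
  then show ?case
    by (simp add: Suc exp_add pochhammer_Suc algebra_simps)
qed auto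

text \<open>For fixed \<open>s\<close>, the approximation satisfies the same asymptotic shift relation
  \<open>\<Gamma>(s + m) / \<Gamma>(m) \<sim> m\<^sup>s\<close> that characterises the Gamma function. The power is taken as
  \<open>n\<^sup>s\<close> with \<open>n = m - 1\<close> to match Gauss's product for \<open>\<Gamma>\<close>.\<close>
lemma stirling_ratio_tendsto:
  assumes "Re s > 0"
  shows "(\<lambda>n. stirling (s + of_nat (Suc n)) / (stirling (of_nat (Suc n)) * exp (s * of_real (ln (real n)))))
           \<longlonglongrightarrow> 1"
proof -
  define E where "E n = of_nat (Suc n) * (Ln (1 + s / of_nat (Suc n)) - s / of_nat (Suc n))
     + (s - 1 / 2) * Ln (1 + s / of_nat (Suc n)) + s * of_real (ln (real (Suc n)) - ln (real n))" for n
  have l0: "(\<lambda>n. s / of_nat (Suc n)) \<longlonglongrightarrow> 0"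
    by (intro LIMSEQ_Suc[of "\<lambda>n. s / of_nat n"] lim_const_over_n)
  have l2: "(\<lambda>n. Ln (1 + s / of_nat (Suc n))) \<longlonglongrightarrow> Ln (1 + 0)"
    by (intro tendsto_intros l0) auto
  have l3: "(\<lambda>n. ln (real (Suc n)) - ln (real n)) \<longlonglongrightarrow> 0"
    by real_asymp
  have l1: "(\<lambda>n. of_nat (Suc n) * (Ln (1 + s / of_nat (Suc n)) - s / of_nat (Suc n))) \<longlonglongrightarrow> 0"
  proof (rule Lim_null_comparison)
    show "\<forall>\<^sub>F n in sequentially. norm (of_nat (Suc n) * (Ln (1 + s / of_nat (Suc n)) - s / of_nat (Suc n)))
      \<le> norm s ^ 2 / (real (Suc n) - norm s)"
    proof (rule eventually_mono[OF eventually_gt_at_top[of "nat \<lceil>norm s\<rceil>"]])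
      fix n assume "nat \<lceil>norm s\<rceil> < n"
      then have n: "norm s < real (Suc n)" by linarith
      define m where "m = real (Suc n)"
      have m: "m > 0" "norm s < m" using n by (auto simp: m_def)
      have "norm (Ln (1 + s / of_nat (Suc n)) - s / of_nat (Suc n)) \<le> norm (s / of_nat (Suc n)) ^ 2 / (1 - norm (s / of_nat (Suc n)))"
        using n by (intro Ln_approx_linear) (simp add: norm_divide del: of_nat_Suc)
      also have "norm (s / of_nat (Suc n)) = norm s / m" by (simp add: norm_divide m_def del: of_nat_Suc)
      also have "(norm s / m) ^ 2 / (1 - norm s / m) = norm s ^ 2 / (m - norm s) / m"
        using m by (simp add: field_simps power2_eq_square)
      finally have "m * norm (Ln (1 + s / of_nat (Suc n)) - s / of_nat (Suc n)) \<le> norm s ^ 2 / (m - norm s)"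
        using m(1) by (simp only: pos_le_divide_eq mult.commute)
      then show "norm (of_nat (Suc n) * (Ln (1 + s / of_nat (Suc n)) - s / of_nat (Suc n)))
          \<le> norm s ^ 2 / (real (Suc n) - norm s)"
        by (simp only: norm_mult norm_of_nat m_def)
    qed
    show "(\<lambda>n. norm s ^ 2 / (real (Suc n) - norm s)) \<longlonglongrightarrow> 0" by real_asymp
  qed
  have "E \<longlonglongrightarrow> 0 + (s - 1 / 2) * Ln (1 + 0) + s * of_real 0"
    unfolding E_def by (intro tendsto_intros l1 l2 l3)
  then have "(\<lambda>n. exp (E n)) \<longlonglongrightarrow> exp 0" by (intro tendsto_exp) simp
  moreover have "exp (E n) = stirling (s + of_nat (Suc n)) / (stirling (of_nat (Suc n)) * exp (s * of_real (ln (real n))))" for n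
  proof -
    define m where "m = real (Suc n)"
    have m: "m > 0" and mc: "of_nat (Suc n) = complex_of_real m" by (auto simp: m_def)
    have nz: "1 + s / of_real m \<noteq> 0"
    proof
      assume "1 + s / of_real m = 0"
      then have "s = - of_real m" using m by (simp add: field_simps add_eq_0_iff)
      then show False using assms m by auto
    qed
    have "Ln (of_real m * (1 + s / of_real m)) = ln m + Ln (1 + s / of_real m)"
      using Ln_times_of_real[OF m nz] m by (simp add: Ln_of_real)
    moreover have "of_real m * (1 + s / of_real m) = s + of_real m" using m by (simp add: field_simps)
    ultimately have L: "Ln (s + of_real m) = ln m + Ln (1 + s / of_real m)" by simp
    have "E n = (s + of_real m - 1 / 2) * Ln (s + of_real m) - (s + of_real m)
         - ((of_real m - 1 / 2) * Ln (of_real m) - of_real m + s * of_real (ln (real n)))"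
      unfolding E_def mc L m_def[symmetric] using m by (simp add: Ln_of_real algebra_simps)
    then show ?thesis unfolding stirling_def mc by (simp only: exp_diff exp_add)
  qed
  ultimately show ?thesis by simp
qed

text \<open>Shifting the argument by \<open>n\<close> multiplies \<open>stirling s\<close> by the same Pochhammer symbol as \<open>\<Gamma>(s)\<close>, and by
  the exponential of a partial sum of Gudermann's series, which is bounded uniformly in \<open>s\<close> and \<open>n\<close>.
  Far out the two functions agree up to a constant, so they are comparable everywhere. The shifts of \<open>s\<close>
  are compared with those of \<open>1\<close>, because Gauss's product is normalised by \<open>n! = \<Gamma>(1 + n)\<close>.\<close>
lemma stirling_bound:
  assumes "\<delta> > 0"
  obtains C where "C > 0" "\<And>s. Re s \<ge> \<delta> \<Longrightarrow> norm (Gamma s) \<le> C * norm (stirling s)"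
    "\<And>s. Re s \<ge> \<delta> \<Longrightarrow> norm (stirling s) \<le> C * norm (Gamma s)"
proof -
  \<comment> \<open>The sums starting at \<open>s\<close> and those starting at \<open>1\<close> are bounded by the same constant.\<close>
  define a where "a = min \<delta> 1"
  have a: "a > 0" "a \<le> \<delta>" "a \<le> 1" using assms by (auto simp: a_def)
  have summ: "summable (\<lambda>k. 1 / (a + real k) ^ 2)"
  proof (rule summable_comparison_test_ev)
    show "summable (\<lambda>k. 1 / real k ^ 2)" using inverse_power_summable[of 2] by (simp add: field_simps)
    show "\<forall>\<^sub>F k in sequentially. norm (1 / (a + real k) ^ 2) \<le> 1 / real k ^ 2"
      using eventually_gt_at_top[of 0]
      by eventually_elim (use a in \<open>auto intro!: frac_le power_mono\<close>)
  qed
  define K where "K = (\<Sum>k. 1 / (a + real k) ^ 2)"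
  have sumK: "norm (\<Sum>k<n. gudermann (s + of_nat k)) \<le> K" if "Re s \<ge> a" for s n
  proof -
    have "norm (\<Sum>k<n. gudermann (s + of_nat k)) \<le> (\<Sum>k<n. 1 / (a + real k) ^ 2)"
    proof (rule sum_norm_le)
      fix k
      have "norm (gudermann (s + of_nat k)) \<le> 1 / norm (s + of_nat k) ^ 2"
        using that a by (intro norm_gudermann_le) auto
      also have "a + real k \<le> norm (s + of_nat k)"
        using complex_Re_le_cmod[of "s + of_nat k"] that by simp
      then have "1 / norm (s + of_nat k) ^ 2 \<le> 1 / (a + real k) ^ 2"
        using a by (intro divide_left_mono power_mono mult_pos_pos) auto
      finally show "norm (gudermann (s + of_nat k)) \<le> 1 / (a + real k) ^ 2" .
    qed
    also have "\<dots> \<le> K" unfolding K_def using summ by (intro sum_le_suminf) auto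
    finally show ?thesis .
  qed
  define r where "r s n = norm (stirling (s + of_nat (Suc n)) / (stirling (of_nat (Suc n)) * exp (s * of_real (ln (real n)))))" for s n
  define d where "d s n = Re ((\<Sum>k<n. gudermann (1 + of_nat k)) - (\<Sum>k<Suc n. gudermann (s + of_nat k)))" for s n
  have d: "\<bar>d s n\<bar> \<le> 2 * K" if "Re s \<ge> a" for s n
  proof -
    have "\<bar>d s n\<bar> \<le> norm ((\<Sum>k<n. gudermann (1 + of_nat k)) - (\<Sum>k<Suc n. gudermann (s + of_nat k)))"
      unfolding d_def by (rule abs_Re_le_cmod)
    also have "\<dots> \<le> K + K"
      by (rule order_trans[OF norm_triangle_ineq4]) (intro add_mono sumK that, use a in auto)
    finally show ?thesis by simp
  qed
  \<comment> \<open>Gauss's product, corrected by a ratio tending to 1 and by the two partial sums of Gudermann's series:\<close>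
  have key: "norm (stirling s) = r s n * exp (-1) * norm (Gamma_series s n) * exp (d s n)" if s: "Re s > 0" for s n
  proof -
    have st1: "norm (stirling 1) = exp (-1)" by (simp add: stirling_def)
    have "Re 1 > 0" by simp
    from stirling_plus_of_nat[OF this, of n]
    have n1: "stirling (of_nat (Suc n)) = fact n * stirling 1 * exp (\<Sum>k<n. gudermann (1 + of_nat k))"
      by (simp add: pochhammer_fact)
    have nz: "s \<noteq> - of_nat k" for k using s by (auto simp: complex_eq_iff)
    have pz: "pochhammer s (Suc n) \<noteq> 0" using nz by (auto simp: pochhammer_eq_0_iff)
    have r: "r s n = norm (pochhammer s (Suc n)) * norm (stirling s) * exp (Re (\<Sum>k<Suc n. gudermann (s + of_nat k)))
      / (fact n * exp (-1) * exp (Re (\<Sum>k<n. gudermann (1 + of_nat k))) * norm (exp (s * of_real (ln (real n)))))"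
      unfolding r_def stirling_plus_of_nat[OF s, of "Suc n"] n1
      by (simp add: norm_divide norm_mult st1 del: sum.lessThan_Suc)
    have g: "norm (Gamma_series s n) = fact n * norm (exp (s * of_real (ln (real n)))) / norm (pochhammer s (Suc n))"
      by (simp add: Gamma_series_def norm_divide norm_mult)
    have cancel: "S = P * S * b / (f * e * c * X) * e * (f * X / P) * (c / b)"
      if "P > 0" "X > 0" "b > 0" "c > 0" "e > 0" "f > 0" for P S b f e c X :: real
      using that by (simp add: field_simps)
    show ?thesis unfolding r g d_def minus_complex.sel exp_diff
      by (rule cancel) (use pz in simp_all)
  qed
  have lim: "(\<lambda>n. r s n * exp (-1) * norm (Gamma_series s n) * c) \<longlonglongrightarrow> norm (1 :: complex) * exp (-1) * norm (Gamma s) * c"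
    if "Re s > 0" for s c
    unfolding r_def by (intro tendsto_intros stirling_ratio_tendsto[OF that] Gamma_series_LIMSEQ)
  have rpos: "r s n * exp (-1) * norm (Gamma_series s n) \<ge> 0" for s n by (simp add: r_def)
  have "norm (stirling s) \<le> norm (1 :: complex) * exp (-1) * norm (Gamma s) * exp (2 * K)" if "Re s \<ge> \<delta>" for s
  proof (rule tendsto_lowerbound[OF lim])
    show "\<forall>\<^sub>F n in sequentially. norm (stirling s) \<le> r s n * exp (-1) * norm (Gamma_series s n) * exp (2 * K)"
    proof (rule always_eventually, rule allI)
      fix n show "norm (stirling s) \<le> r s n * exp (-1) * norm (Gamma_series s n) * exp (2 * K)"
        using key[of s n] d[of s n] that a rpos[of s n] by (auto intro!: mult_left_mono)
    qed
  qed (use that assms in auto)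
  moreover have "norm (1 :: complex) * exp (-1) * norm (Gamma s) * exp (-2 * K) \<le> norm (stirling s)" if "Re s \<ge> \<delta>" for s
  proof (rule tendsto_upperbound[OF lim])
    show "\<forall>\<^sub>F n in sequentially. r s n * exp (-1) * norm (Gamma_series s n) * exp (-2 * K) \<le> norm (stirling s)"
    proof (rule always_eventually, rule allI)
      fix n show "r s n * exp (-1) * norm (Gamma_series s n) * exp (-2 * K) \<le> norm (stirling s)"
        using key[of s n] d[of s n] that a rpos[of s n] by (auto intro!: mult_left_mono)
    qed
  qed (use that assms in auto)
  ultimately have b: "norm (stirling s) \<le> exp (2 * K - 1) * norm (Gamma s)"
     "norm (Gamma s) \<le> exp (2 * K + 1) * norm (stirling s)" if "Re s \<ge> \<delta>" for s
    using that by (auto simp: exp_diff exp_add exp_minus field_simps)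
  show ?thesis
  proof (rule that[of "exp (2 * K + 1)"])
    fix s assume s: "Re s \<ge> \<delta>"
    have "norm (stirling s) \<le> exp (2 * K - 1) * norm (Gamma s)" using b s by blast
    also have "\<dots> \<le> exp (2 * K + 1) * norm (Gamma s)" by (intro mult_right_mono) auto
    finally show "norm (stirling s) \<le> exp (2 * K + 1) * norm (Gamma s)" .
  qed (use b in auto)
qed

section \<open>Growth of the interpolated coefficients\<close>

text \<open>The function \<open>H\<close> of the introduction. With the entire function \<open>rGamma = 1 / \<Gamma>\<close> in the
  denominators it is visibly holomorphic for \<open>Re s > 1 / (2 - p)\<close>.\<close>
definition mb_coeff :: "real \<Rightarrow> complex \<Rightarrow> complex" where
  "mb_coeff p s = rGamma (s + 1) * (Gamma (s * (2 - of_real p) - 1) * rGamma (s * (1 - of_real p)))"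

lemma Re_pos_not_nonpos_Int: "Re s > 0 \<Longrightarrow> s \<notin> \<int>\<^sub>\<le>\<^sub>0"
  by (auto elim!: nonpos_Ints_cases)

text \<open>The reflection formula isolates all poles in the factor \<open>1 / sin \<pi>s\<close>. At a positive integer \<open>s\<close> both
  sides are \<open>0\<close>, as \<open>\<Gamma>\<close> vanishes at its poles and division by zero gives zero.\<close>
lemma mb_integrand_eq:
  assumes "Re s > 0"
  shows "mb_integrand p \<epsilon> s = - of_real pi * mb_coeff p s * neg_cpow \<epsilon> s / sin (of_real pi * s)"
proof -
  have s: "s \<notin> \<int>\<^sub>\<le>\<^sub>0" using assms by (rule Re_pos_not_nonpos_Int)
  then have nz: "s \<noteq> 0" "Gamma s \<noteq> 0" by (auto simp: Gamma_eq_zero_iff)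
  have "Gamma (- s) = - of_real pi / (s * sin (of_real pi * s)) / Gamma s"
    unfolding Gamma_reflection_complex'[symmetric] using nz by simp
  also have "\<dots> = - of_real pi * rGamma (s + 1) / sin (of_real pi * s)"
    using nz s by (simp add: rGamma_inverse_Gamma Gamma_plus1 divide_simps)
  finally show ?thesis
    by (simp add: mb_integrand_def mb_coeff_def rGamma_inverse_Gamma divide_inverse mult_ac)
qed

lemma exp_half_ln: "x > 0 \<Longrightarrow> exp (ln x / 2) = sqrt x"
  using exp_ln[of "sqrt x"] by (simp only: ln_sqrt real_sqrt_gt_0_iff)

text \<open>As \<open>a = b + 1\<close>, the terms \<open>s * Ln s\<close> in the three exponents cancel. What remains is exponential
  in \<open>s\<close>, so that its modulus depends on \<open>Re s\<close> only, up to the factor \<open>sqrt s\<close>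
  coming from the three summands \<open>- 1 / 2\<close>.\<close>
lemma stirling_quotient:
  assumes "s \<noteq> 0" and "a > 0" and "b > 0" and "a = b + (1 :: real)"
  shows "norm (stirling (s * of_real a)) =
     sqrt (b / a) * exp (Re s * (a * ln a - b * ln b)) * sqrt (norm s) * (norm (stirling s) * norm (stirling (s * of_real b)))"
proof -
  have La: "Ln (s * of_real a) = of_real (ln a) + Ln s" "Ln (s * of_real b) = of_real (ln b) + Ln s"
  proof -
    have "Ln (s * of_real r) = of_real (ln r) + Ln s" if "r > 0" for r :: real
      using Ln_times_of_real[OF that assms(1)] that by (simp add: Ln_of_real mult.commute)
    then show "Ln (s * of_real a) = of_real (ln a) + Ln s" "Ln (s * of_real b) = of_real (ln b) + Ln s"
      using assms by blast+
  qed
  define k where "k = (ln b - ln a) / 2"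
  have "(s * of_real a - 1 / 2) * Ln (s * of_real a) - s * of_real a
      = of_real k + s * of_real (a * ln a - b * ln b) + Ln s / 2
        + (((s - 1 / 2) * Ln s - s) + ((s * of_real b - 1 / 2) * Ln (s * of_real b) - s * of_real b))"
    unfolding La unfolding assms(4) k_def by (simp add: field_simps)
  then have "stirling (s * of_real a) = exp (of_real k) * exp (s * of_real (a * ln a - b * ln b)) * exp (Ln s / 2)
     * (stirling s * stirling (s * of_real b))"
    unfolding stirling_def by (simp only: exp_add)
  moreover have "exp k = sqrt (b / a)"
    using exp_half_ln[of "b / a"] assms by (simp add: k_def ln_div)
  moreover have "norm (exp (Ln s / 2)) = sqrt (norm s)"
    using exp_half_ln[of "norm s"] assms by simp
  ultimately show ?thesis by (simp add: norm_mult)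
qed

text \<open>Two applications of the functional equation bring the quotient of Gamma functions to the form
  \<open>\<Gamma>(s a) / (\<Gamma>(s) \<Gamma>(s b))\<close> with \<open>a = 2 - p\<close> and \<open>b = 1 - p\<close>, at the cost of the factor
  \<open>1 / (s (s a - 1))\<close>. This factor is of order \<open>|s|\<close> to the power \<open>-2\<close>, because \<open>s\<close> stays to the right of the pole
  at \<open>1 / a\<close>; together with \<open>sqrt |s|\<close> from the Stirling quotient it gives the exponent \<open>-3/2\<close>.
  The exponential rate \<open>a ln a - b ln b\<close> is \<open>- ln u_star\<close>.\<close>
lemma mb_coeff_bound:
  assumes p: "0 < p" "p < 1" and \<gamma>: "1 / (2 - p) < \<gamma>"
  obtains C where "C > 0"
    "\<And>s. Re s \<ge> \<gamma> \<Longrightarrow> norm (mb_coeff p s) \<le> C * u_star p powr (- Re s) * norm s powr (- 3 / 2)"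
proof -
  define a b where "a = 2 - p" and "b = 1 - p"
  have ab: "a > 0" "b > 0" "a = b + 1" "b < 1" "a > 1" using p by (auto simp: a_def b_def)
  have "1 < \<gamma> * a" using \<gamma> ab by (simp add: a_def field_simps)
  have \<gamma>0: "\<gamma> > 0" using \<gamma> ab by (smt (verit) a_def divide_pos_pos)
  \<comment> \<open>The slope for which \<open>|s a - 1| \<ge> c |s|\<close>: as \<open>|s| \<ge> \<gamma>\<close>, the summand \<open>1\<close> is at most \<open>|s| / \<gamma>\<close>.\<close>
  define c where "c = a - 1 / \<gamma>"
  have c: "c > 0" using \<open>1 < \<gamma> * a\<close> \<gamma>0 by (simp add: c_def field_simps)
  obtain C where C: "C > 0" "\<And>s. Re s \<ge> \<gamma> * b \<Longrightarrow> norm (Gamma s) \<le> C * norm (stirling s)"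
    "\<And>s. Re s \<ge> \<gamma> * b \<Longrightarrow> norm (stirling s) \<le> C * norm (Gamma s)"
    using stirling_bound[of "\<gamma> * b"] \<gamma>0 ab by auto
  show ?thesis
  proof (rule that[of "C ^ 3 * sqrt (b / a) / c"])
    show "C ^ 3 * sqrt (b / a) / c > 0" using C c ab by simp
    fix s assume s: "Re s \<ge> \<gamma>"
    have bb: "\<gamma> * b \<le> \<gamma> * 1" "\<gamma> * b \<le> Re s * b" "Re s * b \<le> Re s * a"
      using ab \<gamma>0 s by (intro mult_left_mono mult_right_mono; simp)+
    have Re: "Re s \<ge> \<gamma> * b" "Re (s * of_real a) \<ge> \<gamma> * b" "Re (s * of_real b) \<ge> \<gamma> * b"
      using bb s by auto
    have s0: "s \<noteq> 0" using s \<gamma>0 by auto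
    have ns: "norm s \<ge> \<gamma>" "norm s > 0" using s complex_Re_le_cmod[of s] \<gamma>0 by linarith+
    have "Re s * a \<ge> \<gamma> * a" using s ab by (intro mult_right_mono) auto
    then have Re1: "Re (s * of_real a - 1) > 0" using \<open>1 < \<gamma> * a\<close> by simp
    have n1: "norm (s * of_real a - 1) \<ge> c * norm s"
    proof -
      have "norm (s * of_real a - 1) \<ge> norm (s * of_real a) - norm (1 :: complex)" by (rule norm_triangle_ineq2)
      moreover have "norm (s * of_real a) = norm s * a" using ab by (simp add: norm_mult)
      moreover have "1 \<le> norm s / \<gamma>" using ns \<gamma>0 by simp
      ultimately show ?thesis by (simp add: c_def algebra_simps)
    qed
    have nz: "s * of_real a - 1 \<noteq> 0" using Re1 by (intro notI) (simp only: zero_complex.sel)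
    have "Gamma (s * of_real a) = (s * of_real a - 1) * Gamma (s * of_real a - 1)"
      using Gamma_plus1[OF Re_pos_not_nonpos_Int[OF Re1]] by simp
    then have G1: "Gamma (s * of_real a - 1) = Gamma (s * of_real a) / (s * of_real a - 1)"
      using nz by (simp add: field_simps)
    have G2: "rGamma (s + 1) = inverse (s * Gamma s)"
      using Gamma_plus1[OF Re_pos_not_nonpos_Int, of s] s \<gamma>0 by (simp add: rGamma_inverse_Gamma)
    have "mb_coeff p s = Gamma (s * of_real a) / (s * of_real a - 1) / (s * Gamma s) / Gamma (s * of_real b)"
      using G1 G2 by (simp add: mb_coeff_def a_def b_def rGamma_inverse_Gamma field_simps)
    then have "norm (mb_coeff p s) = norm (Gamma (s * of_real a)) / norm (s * of_real a - 1) / (norm s * norm (Gamma s)) / norm (Gamma (s * of_real b))"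
      by (simp add: norm_divide norm_mult)
    also have "\<dots> \<le> (C * norm (stirling (s * of_real a))) / (c * norm s) / (norm s * (norm (stirling s) / C)) / (norm (stirling (s * of_real b)) / C)"
    proof -
      have pos: "norm (stirling s) > 0" "norm (stirling (s * of_real b)) > 0" by (auto simp: stirling_def)
      have "norm (stirling s) / C \<le> norm (Gamma s)" "norm (stirling (s * of_real b)) / C \<le> norm (Gamma (s * of_real b))"
        using C Re by (auto simp: field_simps)
      then show ?thesis using C c ns pos n1 Re
        by (intro frac_le mult_mono divide_nonneg_nonneg mult_pos_pos divide_pos_pos mult_nonneg_nonneg) auto
    qed
    also have "\<dots> = C ^ 3 * sqrt (b / a) / c * exp (Re s * (a * ln a - b * ln b)) * (sqrt (norm s) / norm s ^ 2)"
    proof -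
      have pos: "norm (stirling s) > 0" "norm (stirling (s * of_real b)) > 0" by (auto simp: stirling_def)
      have cancel: "C * (q * E * r * (x * y)) / (c * n) / (n * (x / C)) / (y / C) = C ^ 3 * q / c * E * (r / n ^ 2)"
        if "x > 0" "y > 0" "n > 0" for q E r x y n :: real
        using that C c by (simp add: field_simps power2_eq_square power3_eq_cube)
      show ?thesis unfolding stirling_quotient[OF s0 ab(1-3)] using pos ns by (intro cancel)
    qed
    also have "exp (Re s * (a * ln a - b * ln b)) = u_star p powr (- Re s)"
    proof -
      have "ln (u_star p) = b * ln b - a * ln a" "u_star p > 0"
        using ab by (auto simp: u_star_def ln_div ln_powr simp flip: a_def b_def)
      then show ?thesis by (simp only: powr_def) (simp add: algebra_simps)
    qed
    also have "sqrt (norm s) / norm s ^ 2 = norm s powr (- 3 / 2)"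
    proof -
      have e: "(- 3 / 2 :: real) = 1 / 2 - 2" by simp
      have "norm s powr (1 / 2) = sqrt (norm s)" "norm s powr 2 = norm s ^ 2"
        using ns powr_realpow[of "norm s" 2] by (simp_all add: powr_half_sqrt)
      then show ?thesis by (simp only: e powr_diff)
    qed
    finally show "norm (mb_coeff p s) \<le> C ^ 3 * sqrt (b / a) / c * u_star p powr (- Re s) * norm s powr (- 3 / 2)" .
  qed
qed

lemma norm_neg_cpow:
  assumes "\<epsilon> > 0"
  shows "norm (neg_cpow \<epsilon> s) = \<epsilon> powr Re s * exp (- pi * Im s)"
  using assms by (simp add: neg_cpow_def powr_def exp_diff exp_minus divide_inverse algebra_simps)

lemma mb_coeff_neg_cpow_bound:
  assumes p: "0 < p" "p < 1" and \<epsilon>: "0 < \<epsilon>" "\<epsilon> \<le> u_star p" and \<gamma>: "1 / (2 - p) < \<gamma>"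
  obtains C where "C > 0"
    "\<And>s. Re s \<ge> \<gamma> \<Longrightarrow> norm (mb_coeff p s * neg_cpow \<epsilon> s) \<le> C * exp (- pi * Im s) * norm s powr (- 3 / 2)"
proof -
  obtain C where C: "C > 0"
    "\<And>s. Re s \<ge> \<gamma> \<Longrightarrow> norm (mb_coeff p s) \<le> C * u_star p powr (- Re s) * norm s powr (- 3 / 2)"
    using mb_coeff_bound[OF p \<gamma>] by blast
  have \<gamma>0: "\<gamma> > 0" using \<gamma> p by (smt (verit) divide_pos_pos)
  show ?thesis
  proof (rule that[OF C(1)])
    fix s assume s: "Re s \<ge> \<gamma>"
    have "norm (mb_coeff p s * neg_cpow \<epsilon> s)
        \<le> C * u_star p powr (- Re s) * norm s powr (- 3 / 2) * (u_star p powr Re s * exp (- pi * Im s))"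
      unfolding norm_mult norm_neg_cpow[OF \<epsilon>(1)]
      using C s \<epsilon> \<gamma>0 by (intro mult_mono powr_mono2) auto
    also have "\<dots> = C * exp (- pi * Im s) * norm s powr (- 3 / 2)"
      using \<epsilon> by (simp add: powr_minus field_simps)
    finally show "norm (mb_coeff p s * neg_cpow \<epsilon> s) \<le> C * exp (- pi * Im s) * norm s powr (- 3 / 2)" .
  qed
qed

text \<open>Writing \<open>x = exp (\<pi> Im s)\<close>, one has
  \<open>4 |sin \<pi>s|\<^sup>2 = x\<^sup>2 + 1 / x\<^sup>2 - 2 cos (2\<pi> Re s)\<close>. This is at least a fixed multiple of \<open>1 / x\<^sup>2\<close> as long
  as either the cosine stays below 1, which is the case on the given line and on the lines with
  half-integral abscissa, or \<open>x\<close> stays away from 1.\<close>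
lemma sin_lower_bound:
  assumes "\<gamma> \<notin> \<int>"
  obtains c where "c > 0"
    "\<And>s. Re s = \<gamma> \<or> (\<exists>n :: nat. Re s = n + 1 / 2) \<or> \<bar>Im s\<bar> \<ge> 1 / 2 \<Longrightarrow>
       c * exp (- pi * Im s) \<le> norm (sin (of_real pi * s))"
proof -
  define \<kappa> where "\<kappa> = max 0 (cos (2 * (pi * \<gamma>)))"
  have "cos (2 * (pi * \<gamma>)) \<noteq> 1"
  proof
    assume "cos (2 * (pi * \<gamma>)) = 1"
    then obtain k :: int where "2 * (pi * \<gamma>) = of_int k * 2 * pi" using cos_one_2pi_int[of "2 * (pi * \<gamma>)"] by auto
    then have "\<gamma> = of_int k" by simp
    then show False using assms by auto
  qed
  then have "cos (2 * (pi * \<gamma>)) < 1" using cos_le_one[of "2 * (pi * \<gamma>)"] by linarith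
  then have \<kappa>: "0 \<le> \<kappa>" "\<kappa> < 1" by (auto simp: \<kappa>_def)
  define c where "c = min (sqrt (1 - \<kappa>) / 2) (1 / 4)"
  have c: "c > 0" "c\<^sup>2 \<le> (1 - \<kappa>) / 4" "c\<^sup>2 \<le> 1 / 16"
  proof -
    show "c > 0" using \<kappa> by (simp add: c_def)
    have "c\<^sup>2 \<le> (sqrt (1 - \<kappa>) / 2)\<^sup>2" "c\<^sup>2 \<le> (1 / 4)\<^sup>2"
      using \<open>c > 0\<close> by (intro power_mono; simp add: c_def)+
    then show "c\<^sup>2 \<le> (1 - \<kappa>) / 4" "c\<^sup>2 \<le> 1 / 16" using \<kappa> by (auto simp: power_divide)
  qed
  show ?thesis
  proof (rule that[OF c(1)])
    fix s :: complex
    assume A: "Re s = \<gamma> \<or> (\<exists>n :: nat. Re s = n + 1 / 2) \<or> \<bar>Im s\<bar> \<ge> 1 / 2"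
    define x where "x = exp (pi * Im s)"
    have x: "x > 0" by (simp add: x_def)
    have e2: "exp (2 * (pi * Im s)) = x\<^sup>2" by (simp add: x_def exp_double)
    have S: "norm (sin (of_real pi * s)) ^ 2 = (x\<^sup>2 + inverse (x\<^sup>2) - 2 * cos (2 * (pi * Re s))) / 4"
      using norm_sin_squared[of "of_real pi * s"] by (simp add: e2)
    have am: "x\<^sup>2 + inverse (x\<^sup>2) \<ge> 2"
    proof -
      have "x\<^sup>2 + inverse (x\<^sup>2) - 2 = (x - inverse x)\<^sup>2"
        using x by (simp add: power2_eq_square field_simps)
      then show ?thesis by (smt (verit) zero_le_power2)
    qed
    have cosb: "(1 - k) * inverse (x\<^sup>2) \<le> x\<^sup>2 + inverse (x\<^sup>2) - 2 * cos (2 * (pi * Re s))"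
      if "cos (2 * (pi * Re s)) \<le> k" "0 \<le> k" "k \<le> 1" for k
    proof -
      have "k * 2 \<le> k * (x\<^sup>2 + inverse (x\<^sup>2))" using am that by (intro mult_left_mono) auto
      moreover have "k * x\<^sup>2 \<le> 1 * x\<^sup>2" using that by (intro mult_right_mono) auto
      ultimately show ?thesis using that by (simp add: algebra_simps)
    qed
    have "c\<^sup>2 * inverse (x\<^sup>2) \<le> norm (sin (of_real pi * s)) ^ 2"
      using A
    proof (elim disjE exE)
      assume "Re s = \<gamma>"
      then have "(1 - \<kappa>) * inverse (x\<^sup>2) \<le> 4 * norm (sin (of_real pi * s)) ^ 2"
        using cosb[of \<kappa>] \<kappa> unfolding S by (simp add: \<kappa>_def)
      moreover have "c\<^sup>2 * inverse (x\<^sup>2) \<le> (1 - \<kappa>) / 4 * inverse (x\<^sup>2)"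
        using c by (intro mult_right_mono) auto
      ultimately show ?thesis by simp
    next
      fix n :: nat assume "Re s = n + 1 / 2"
      then have "cos (2 * (pi * Re s)) = cos (of_nat n * (2 * pi) + pi)"
        by (intro arg_cong[where f = cos]) (simp add: algebra_simps)
      also have "\<dots> = - cos (2 * real n * pi)" by (simp add: mult_ac)
      also have "\<dots> \<le> 0" using cos_2npi[of n] by (simp add: mult_ac)
      finally have "inverse (x\<^sup>2) \<le> 4 * norm (sin (of_real pi * s)) ^ 2"
        using cosb[of 0] unfolding S by simp
      moreover have "c\<^sup>2 * inverse (x\<^sup>2) \<le> 1 / 16 * inverse (x\<^sup>2)"
        using c by (intro mult_right_mono) auto
      ultimately show ?thesis using x by (simp add: field_simps)
    next
      assume im: "\<bar>Im s\<bar> \<ge> 1 / 2"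
      have "\<bar>x\<^sup>2 - 1\<bar> \<ge> 1 / 2"
      proof (cases "Im s \<ge> 0")
        case True
        have "1 + 2 * (pi * Im s) \<le> x\<^sup>2" using exp_ge_add_one_self[of "2 * (pi * Im s)"] e2 by simp
        moreover have "pi * Im s \<ge> 3 * (1 / 2)" using im True pi_gt3 by (intro mult_mono) auto
        ultimately show ?thesis by simp
      next
        case False
        have "1 + 2 * (pi * (- Im s)) \<le> exp (2 * (pi * (- Im s)))" by (rule exp_ge_add_one_self)
        also have "\<dots> = inverse (x\<^sup>2)" by (simp flip: e2 exp_minus)
        finally have "1 + 2 * (pi * (- Im s)) \<le> inverse (x\<^sup>2)" .
        moreover have "pi * (- Im s) \<ge> 3 * (1 / 2)" using im False pi_gt3 by (intro mult_mono) auto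
        ultimately have "2 \<le> inverse (x\<^sup>2)" by simp
        then have "x\<^sup>2 \<le> 1 / 2" using x by (simp add: field_simps)
        then show ?thesis by simp
      qed
      then have "(1 / 2)\<^sup>2 \<le> \<bar>x\<^sup>2 - 1\<bar>\<^sup>2" by (intro power_mono) auto
      then have "1 / 4 * inverse (x\<^sup>2) \<le> (x\<^sup>2 - 1)\<^sup>2 * inverse (x\<^sup>2)"
        using x by (intro mult_right_mono) (auto simp: power_divide)
      also have "\<dots> = x\<^sup>2 + inverse (x\<^sup>2) - 2" using x by (simp add: power2_eq_square field_simps)
      also have "\<dots> \<le> 4 * norm (sin (of_real pi * s)) ^ 2"
        unfolding S using cos_le_one[of "2 * (pi * Re s)"] by simp
      finally have "1 / 16 * inverse (x\<^sup>2) \<le> norm (sin (of_real pi * s)) ^ 2" by simp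
      moreover have "c\<^sup>2 * inverse (x\<^sup>2) \<le> 1 / 16 * inverse (x\<^sup>2)"
        using c by (intro mult_right_mono) auto
      ultimately show ?thesis by simp
    qed
    moreover have "(c * exp (- pi * Im s))\<^sup>2 = c\<^sup>2 * inverse (x\<^sup>2)"
      by (simp add: x_def power_mult_distrib exp_minus power_inverse)
    ultimately show "c * exp (- pi * Im s) \<le> norm (sin (of_real pi * s))"
      by (intro power2_le_imp_le[OF _ norm_ge_zero]) simp
  qed
qed

section \<open>Bounds on the integrand and on the terms of the series\<close>

text \<open>The admissible points include all sides of the contours used below.\<close>
lemma mb_integrand_bound:
  assumes p: "0 < p" "p < 1" and \<epsilon>: "0 < \<epsilon>" "\<epsilon> \<le> u_star p" and \<gamma>: "1 / (2 - p) < \<gamma>" "\<gamma> \<notin> \<int>"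
  obtains M where "M > 0"
    "\<And>s. Re s \<ge> \<gamma> \<Longrightarrow> Re s = \<gamma> \<or> (\<exists>n :: nat. Re s = n + 1 / 2) \<or> \<bar>Im s\<bar> \<ge> 1 / 2 \<Longrightarrow>
       norm (mb_integrand p \<epsilon> s) \<le> M * norm s powr (- 3 / 2)"
proof -
  obtain C where C: "C > 0"
    "\<And>s. Re s \<ge> \<gamma> \<Longrightarrow> norm (mb_coeff p s * neg_cpow \<epsilon> s) \<le> C * exp (- pi * Im s) * norm s powr (- 3 / 2)"
    using mb_coeff_neg_cpow_bound[OF p \<epsilon> \<gamma>(1)] by blast
  obtain c where c: "c > 0"
    "\<And>s. Re s = \<gamma> \<or> (\<exists>n :: nat. Re s = n + 1 / 2) \<or> \<bar>Im s\<bar> \<ge> 1 / 2 \<Longrightarrow>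
       c * exp (- pi * Im s) \<le> norm (sin (of_real pi * s))"
    using sin_lower_bound[OF \<gamma>(2)] by blast
  have \<gamma>0: "\<gamma> > 0" using \<gamma> p by (smt (verit) divide_pos_pos)
  show ?thesis
  proof (rule that[of "pi * C / c"])
    show "pi * C / c > 0" using C c by simp
    fix s assume s: "Re s \<ge> \<gamma>" and A: "Re s = \<gamma> \<or> (\<exists>n :: nat. Re s = n + 1 / 2) \<or> \<bar>Im s\<bar> \<ge> 1 / 2"
    have "norm (mb_integrand p \<epsilon> s) = pi * norm (mb_coeff p s * neg_cpow \<epsilon> s) / norm (sin (of_real pi * s))"
      using s \<gamma>0 by (subst mb_integrand_eq) (auto simp: norm_mult norm_divide)
    also have "\<dots> \<le> pi * (C * exp (- pi * Im s) * norm s powr (- 3 / 2)) / (c * exp (- pi * Im s))"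
      using C(1) c(1) C(2)[OF s] c(2)[OF A] by (intro frac_le mult_left_mono mult_nonneg_nonneg mult_pos_pos) simp_all
    also have "\<dots> = pi * C / c * norm s powr (- 3 / 2)"
      using c by (simp add: field_simps)
    finally show "norm (mb_integrand p \<epsilon> s) \<le> pi * C / c * norm s powr (- 3 / 2)" .
  qed
qed

text \<open>The integrable majorant for the integrand on the line \<open>Re s = \<gamma>\<close>.\<close>
lemma integrable_one_plus_abs_powr: "integrable lborel (\<lambda>t :: real. (1 + \<bar>t\<bar>) powr (- 3 / 2))"
proof -
  define h :: "real \<Rightarrow> real" where "h t = indicator {0..} t * (1 + t) powr (- 3 / 2)" for t
  have "(\<integral>\<^sup>+ t. ennreal ((1 + t) powr (- 3 / 2)) * indicator {0..} t \<partial>lborel)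
      = ennreal (0 - (- 2 * (1 + 0) powr (- 1 / 2)))"
  proof (rule nn_integral_FTC_atLeast)
    show "((\<lambda>t :: real. - 2 * (1 + t) powr (- 1 / 2)) \<longlongrightarrow> 0) at_top" by real_asymp
    fix t :: real assume t: "0 \<le> t"
    have "((\<lambda>t. - 2 * (1 + t) powr (- 1 / 2)) has_real_derivative - 2 * ((- 1 / 2) * (1 + t) powr (- 1 / 2 - 1) * 1)) (at t)"
      using t by (intro DERIV_cmult DERIV_fun_powr[of "\<lambda>t. 1 + t"]) (auto intro!: derivative_eq_intros)
    then show "((\<lambda>t. - 2 * (1 + t) powr (- 1 / 2)) has_real_derivative (1 + t) powr (- 3 / 2)) (at t)"
      by simp
  qed auto
  then have "(\<integral>\<^sup>+ t. ennreal (h t) \<partial>lborel) < \<infinity>"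
    by (simp add: h_def ennreal_mult'' ennreal_indicator mult.commute flip: ennreal_indicator)
  then have h: "integrable lborel h"
    by (intro integrableI_nonneg) (simp_all add: h_def[abs_def])
  have h': "integrable lborel (\<lambda>t. h (- t))"
    using lborel_integrable_real_affine[OF h, of "- 1" 0] by simp
  show ?thesis
    by (rule Bochner_Integration.integrable_bound[OF Bochner_Integration.integrable_add[OF h h']])
       (auto simp: h_def indicator_def abs_if)
qed

lemma complex_of_real_z_term:
  assumes "n > 0"
  shows "complex_of_real (z_term p \<epsilon> n) = mb_coeff p (of_nat n) * of_real \<epsilon> ^ n"
proof -
  have "fact n = Gamma (of_nat n + 1 :: complex)" using Gamma_fact[of n, where 'a = complex] by (simp add: add.commute)
  then have "mb_coeff p (of_nat n) = inverse (fact n) *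
      (Gamma (of_real (real n * (2 - p) - 1)) * rGamma (of_real (real n * (1 - p))))"
    by (simp add: mb_coeff_def rGamma_inverse_Gamma)
  then show ?thesis
    by (simp only: Gamma_complex_of_real rGamma_complex_of_real)
       (simp add: z_term_def rGamma_inverse_Gamma divide_inverse mult_ac)
qed

text \<open>The coefficient bound at the integers dominates the series by a multiple of the series of
  \<open>n powr (-3/2)\<close>.\<close>
lemma summable_z_term:
  assumes p: "0 < p" "p < 1" and \<epsilon>: "0 < \<epsilon>" "\<epsilon> \<le> u_star p"
  shows "summable (\<lambda>n. z_term p \<epsilon> (Suc n))"
proof -
  have lt1: "1 / (2 - p) < 1" using p by simp
  obtain C where C: "C > 0"
    "\<And>s. Re s \<ge> 1 \<Longrightarrow> norm (mb_coeff p s * neg_cpow \<epsilon> s) \<le> C * exp (- pi * Im s) * norm s powr (- 3 / 2)"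
    using mb_coeff_neg_cpow_bound[OF p \<epsilon> lt1] by blast
  have "summable (\<lambda>n. C * real (Suc n) powr (- 3 / 2))"
    using summable_real_powr_iff[of "- 3 / 2"] by (subst summable_Suc_iff) (intro summable_mult; simp)
  then show ?thesis
  proof (rule summable_comparison_test[rotated], intro exI allI impI)
    fix n
    have "\<bar>z_term p \<epsilon> (Suc n)\<bar> = norm (complex_of_real (z_term p \<epsilon> (Suc n)))" by simp
    also have "\<dots> = norm (mb_coeff p (of_nat (Suc n))) * \<epsilon> ^ Suc n"
      using \<epsilon> by (subst complex_of_real_z_term) (auto simp: norm_mult norm_power)
    also have "\<epsilon> ^ Suc n = norm (neg_cpow \<epsilon> (of_nat (Suc n)))"
      using \<epsilon> by (simp add: norm_neg_cpow powr_realpow del: of_nat_Suc power_Suc)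
    also have "norm (mb_coeff p (of_nat (Suc n))) * norm (neg_cpow \<epsilon> (of_nat (Suc n))) \<le> C * real (Suc n) powr (- 3 / 2)"
      using C(2)[of "of_nat (Suc n)"] by (simp add: norm_mult del: of_nat_Suc)
    finally show "norm (z_term p \<epsilon> (Suc n)) \<le> C * real (Suc n) powr (- 3 / 2)" by simp
  qed
qed

section \<open>Poles and residues\<close>

lemma mb_coeff_holomorphic:
  assumes "0 < p" "p < 1" "A \<subseteq> {s. Re s > 1 / (2 - p)}"
  shows "mb_coeff p holomorphic_on A"
proof -
  have "s * (2 - of_real p) - 1 \<notin> \<int>\<^sub>\<le>\<^sub>0" if "s \<in> A" for s
  proof (rule Re_pos_not_nonpos_Int)
    have "1 / (2 - p) < Re s" using that assms(3) by auto
    then have "1 < Re s * (2 - p)" using assms by (simp add: field_simps)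
    then show "Re (s * (2 - of_real p) - 1) > 0" by simp
  qed
  then show ?thesis unfolding mb_coeff_def by (intro holomorphic_intros)
qed

lemma neg_cpow_holomorphic [holomorphic_intros]: "neg_cpow \<epsilon> holomorphic_on A"
  unfolding neg_cpow_def by (intro holomorphic_intros)

lemma mb_integrand_holomorphic:
  assumes "0 < p" "p < 1" "A \<subseteq> {s. Re s > 1 / (2 - p)}" "A \<inter> \<int> = {}"
  shows "mb_integrand p \<epsilon> holomorphic_on A"
proof -
  have "(\<lambda>s. - of_real pi * mb_coeff p s * neg_cpow \<epsilon> s / sin (of_real pi * s)) holomorphic_on A"
  proof (intro holomorphic_intros mb_coeff_holomorphic assms)
    fix s assume "s \<in> A"
    then have "s \<notin> \<int>" using assms by auto
    show "sin (of_real pi * s) \<noteq> 0"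
    proof
      assume "sin (of_real pi * s) = 0"
      then obtain k :: int where "of_real pi * s = of_real (of_int k * pi)"
        unfolding sin_eq_0 by auto
      then have "s = of_int k" by (simp add: mult.commute)
      then show False using \<open>s \<notin> \<int>\<close> by simp
    qed
  qed
  moreover have "Re s > 0" if "s \<in> A" for s
  proof -
    have "1 / (2 - p) > 0" using assms by simp
    moreover have "Re s > 1 / (2 - p)" using assms(3) that by auto
    ultimately show ?thesis by linarith
  qed
  ultimately show ?thesis
    by (subst holomorphic_cong[OF refl mb_integrand_eq])
qed

text \<open>The sign \<open>(-1)\<^sup>n\<close> in \<open>(-\<epsilon>)\<^sup>n\<close> is cancelled by the derivative \<open>\<pi> cos \<pi>n\<close> of \<open>sin \<pi>s\<close>.\<close>
lemma residue_mb_integrand: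
  assumes p: "0 < p" "p < 1" and \<epsilon>: "0 < \<epsilon>" and n: "n > 0"
  shows "residue (mb_integrand p \<epsilon>) (of_nat n) = - of_real (z_term p \<epsilon> n)"
proof -
  define g where "g s = - of_real pi * mb_coeff p s * neg_cpow \<epsilon> s" for s
  define S where "S = {s. Re s > 1 / (2 - p)}"
  have lt1: "0 < 1 / (2 - p)" "1 / (2 - p) < 1" using p by simp_all
  have "1 \<le> real n" using n by simp
  then have "1 / (2 - p) < real n" using lt1 by linarith
  then have nS: "of_nat n \<in> S" by (simp add: S_def)
  have S: "open S" "connected S" unfolding S_def
    by (auto simp: open_halfspace_Re_gt convex_connected convex_halfspace_Re_gt)
  have "real n * (1 - p) > 0" using p n by simp
  then have "of_real (real n * (1 - p)) \<notin> (\<int>\<^sub>\<le>\<^sub>0 :: complex set)"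
    by (intro Re_pos_not_nonpos_Int) (simp only: Re_complex_of_real)
  moreover have "real n * (2 - p) > 1" using nS p by (simp add: S_def field_simps)
  then have "of_real (real n * (2 - p) - 1) \<notin> (\<int>\<^sub>\<le>\<^sub>0 :: complex set)"
    by (intro Re_pos_not_nonpos_Int) (simp only: Re_complex_of_real)
  moreover have "of_nat n + 1 \<notin> (\<int>\<^sub>\<le>\<^sub>0 :: complex set)"
    by (intro Re_pos_not_nonpos_Int) simp
  ultimately have c0: "mb_coeff p (of_nat n) \<noteq> 0"
    by (simp add: mb_coeff_def rGamma_eq_zero_iff Gamma_eq_zero_iff)
  have s0: "sin (of_real pi * of_nat n :: complex) = 0" 
    using sin_of_real[of "pi * real n", where 'a = complex, symmetric] by simp
  have c1: "cos (of_real pi * of_nat n :: complex) = (- 1) ^ n"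
    using cos_of_real[of "pi * real n", where 'a = complex, symmetric] by simp
  have e: "neg_cpow \<epsilon> (of_nat n) = of_real \<epsilon> ^ n * (- 1) ^ n"
  proof -
    have "neg_cpow \<epsilon> (of_nat n) = exp (of_real (ln \<epsilon>) + \<i> * of_real pi) ^ n"
      by (simp only: neg_cpow_def exp_of_nat_mult)
    also have "exp (of_real (ln \<epsilon>) + \<i> * of_real pi) = - of_real \<epsilon>"
      using \<epsilon> by (simp add: exp_add exp_of_real)
    finally show ?thesis by (simp flip: power_mult_distrib)
  qed
  have "\<forall>\<^sub>F s in at (of_nat n). mb_integrand p \<epsilon> s = g s / sin (of_real pi * s)"
    using eventually_at_in_open'[OF S(1) nS]
  proof eventually_elim
    case (elim s)
    then have "1 / (2 - p) < Re s" by (simp add: S_def)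
    with lt1(1) have "Re s > 0" by linarith
    then show ?case unfolding g_def by (rule mb_integrand_eq)
  qed
  then have "residue (mb_integrand p \<epsilon>) (of_nat n) = residue (\<lambda>s. g s / sin (of_real pi * s)) (of_nat n)"
    by (intro residue_cong) auto
  also have "\<dots> = g (of_nat n) / (of_real pi * cos (of_real pi * of_nat n))"
  proof (rule residue_simple_pole_deriv[OF _ _ S nS])
    show "g holomorphic_on S" unfolding g_def using p
      by (intro holomorphic_intros mb_coeff_holomorphic) (auto simp: S_def)
    show "g (of_nat n) \<noteq> 0" using c0 by (simp add: g_def neg_cpow_def)
    show "((\<lambda>s. sin (of_real pi * s)) has_field_derivative of_real pi * cos (of_real pi * of_nat n)) (at (of_nat n :: complex))"
      by (auto intro!: derivative_eq_intros)
    show "of_real pi * cos (of_real pi * of_nat n :: complex) \<noteq> 0" by (simp add: c1)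
  qed (auto intro!: holomorphic_intros simp: s0)
  also have "\<dots> = - of_real (z_term p \<epsilon> n)"
    by (simp add: g_def e c1 complex_of_real_z_term[OF n] field_simps)
  finally show ?thesis .
qed

section \<open>Closing the contour to the right\<close>

text \<open>The left side is oriented upward here, against the orientation of the rectangle.\<close>
lemma contour_integral_rectpath:
  assumes "continuous_on (path_image (rectpath a b)) f"
  shows "contour_integral (rectpath a b) f =
     contour_integral (linepath a (Complex (Re b) (Im a))) f
   + contour_integral (linepath (Complex (Re b) (Im a)) b) f
   + contour_integral (linepath b (Complex (Re a) (Im b))) f
   - contour_integral (linepath a (Complex (Re a) (Im b))) f"
proof -
  define c d where "c = Complex (Re b) (Im a)" and "d = Complex (Re a) (Im b)"
  have rp: "rectpath a b = linepath a c +++ linepath c b +++ linepath b d +++ linepath d a"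
    by (simp add: rectpath_def c_def d_def Let_def)
  have cont: "continuous_on (closed_segment a c) f" "continuous_on (closed_segment c b) f"
    "continuous_on (closed_segment b d) f" "continuous_on (closed_segment d a) f"
    by (rule continuous_on_subset[OF assms]; simp add: rp path_image_join; blast)+
  note int = cont[THEN contour_integrable_continuous_linepath]
  have "contour_integral (rectpath a b) f =
     contour_integral (linepath a c) f + (contour_integral (linepath c b) f
     + (contour_integral (linepath b d) f + contour_integral (linepath d a) f))"
    unfolding rp using int by (simp add: contour_integrable_joinI)
  also have "contour_integral (linepath d a) f = - contour_integral (linepath a d) f"
    using cont(4) by (intro contour_integral_reverse_linepath) (simp add: closed_segment_commute)
  finally show ?thesis by (simp add: c_def d_def)
qed

lemma vertical_integral_limit:
  assumes int: "vertical_integrable f \<gamma>" and lim: "filterlim T at_top sequentially"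
  shows "(\<lambda>n. contour_integral (linepath (Complex \<gamma> (- T n)) (Complex \<gamma> (T n))) f) \<longlonglongrightarrow> vertical_integral f \<gamma>"
proof -
  define g where "g t = f (Complex \<gamma> t) * \<i>" for t
  have g: "integrable lborel g" using int by (simp add: vertical_integrable_def g_def[abs_def])
  have "(\<lambda>n. LINT t|lborel. indicator {- T n..T n} t *\<^sub>R g t) \<longlonglongrightarrow> integral\<^sup>L lborel g"
  proof (rule integral_dominated_convergence[where w = "\<lambda>t. norm (g t)"])
    show "AE t in lborel. (\<lambda>n. indicator {- T n..T n} t *\<^sub>R g t) \<longlonglongrightarrow> g t"
    proof (rule AE_I2)
      fix t
      have "eventually (\<lambda>n. \<bar>t\<bar> \<le> T n) sequentially"
        using lim by (simp add: filterlim_at_top)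
      then show "(\<lambda>n. indicator {- T n..T n} t *\<^sub>R g t) \<longlonglongrightarrow> g t"
        by (intro tendsto_eventually) (erule eventually_mono, simp add: indicator_def abs_le_iff)
    qed
  qed (use g in \<open>auto simp: indicator_def\<close>)
  moreover have "\<forall>\<^sub>F n in sequentially. (LINT t|lborel. indicator {- T n..T n} t *\<^sub>R g t)
      = contour_integral (linepath (Complex \<gamma> (- T n)) (Complex \<gamma> (T n))) f"
  proof -
    have "eventually (\<lambda>n. 1 \<le> T n) sequentially" using lim by (simp add: filterlim_at_top)
    then show ?thesis
    proof eventually_elim
      case (elim n)
      have "set_integrable lborel {- T n..T n} g"
        unfolding set_integrable_def using g by (intro integrable_mult_indicator) auto
      then have "(LINT t|lborel. indicator {- T n..T n} t *\<^sub>R g t) = integral {- T n..T n} g"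
        by (simp add: set_borel_integral_eq_integral(2) flip: set_lebesgue_integral_def)
      also have "\<dots> = \<i> * integral {- T n..T n} (\<lambda>t. f (Complex \<gamma> t))"
        by (simp add: g_def[abs_def] mult.commute)
      also have "\<dots> = contour_integral (linepath (Complex \<gamma> (- T n)) (Complex \<gamma> (T n))) f"
        using elim by (intro contour_integral_linepath_same_Re[symmetric]) auto
      finally show ?case .
    qed
  qed
  ultimately have "(\<lambda>n. contour_integral (linepath (Complex \<gamma> (- T n)) (Complex \<gamma> (T n))) f) \<longlonglongrightarrow> integral\<^sup>L lborel g"
    by (rule Lim_transform_eventually)
  then show ?thesis by (simp add: vertical_integral_def g_def[abs_def])
qed

lemma vertical_integrable_mb_integrand:
  assumes p: "0 < p" "p < 1" and \<epsilon>: "0 < \<epsilon>" "\<epsilon> \<le> u_star p" and \<gamma>: "1 / (2 - p) < \<gamma>" "\<gamma> \<notin> \<int>"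
  shows "vertical_integrable (mb_integrand p \<epsilon>) \<gamma>"
proof -
  obtain M where M: "M > 0"
    "\<And>s. Re s \<ge> \<gamma> \<Longrightarrow> Re s = \<gamma> \<or> (\<exists>n :: nat. Re s = n + 1 / 2) \<or> \<bar>Im s\<bar> \<ge> 1 / 2 \<Longrightarrow>
       norm (mb_integrand p \<epsilon> s) \<le> M * norm s powr (- 3 / 2)"
    using mb_integrand_bound[OF p \<epsilon> \<gamma>] by blast
  have "1 / (2 - p) > 1 / 2" using p by (simp add: field_simps)
  with \<gamma> have \<gamma>2: "\<gamma> > 1 / 2" by linarith
  have "continuous_on {s. Re s = \<gamma>} (mb_integrand p \<epsilon>)"
  proof (intro holomorphic_on_imp_continuous_on mb_integrand_holomorphic p)
    show "{s. Re s = \<gamma>} \<inter> \<int> = {}" using \<gamma>(2) by (auto elim!: Ints_cases)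
  qed (use \<gamma> in auto)
  then have "continuous_on UNIV (\<lambda>t. mb_integrand p \<epsilon> (Complex \<gamma> t))"
    by (rule continuous_on_compose2) (auto simp: Complex_eq intro!: continuous_intros)
  then have meas: "(\<lambda>t. mb_integrand p \<epsilon> (Complex \<gamma> t) * \<i>) \<in> borel_measurable lborel"
    by (simp add: borel_measurable_continuous_onI continuous_on_mult_right)
  have "norm (mb_integrand p \<epsilon> (Complex \<gamma> t) * \<i>) \<le> norm (M * 4 powr (3 / 2) * (1 + \<bar>t\<bar>) powr (- 3 / 2))" for t
  proof -
    have "1 + \<bar>t\<bar> \<le> 4 * norm (Complex \<gamma> t)"
      using abs_Re_le_cmod[of "Complex \<gamma> t"] abs_Im_le_cmod[of "Complex \<gamma> t"] \<gamma>2 by simp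
    then have "norm (Complex \<gamma> t) powr (- 3 / 2) \<le> ((1 + \<bar>t\<bar>) / 4) powr (- 3 / 2)"
      by (intro powr_mono2') auto
    also have "\<dots> = 4 powr (3 / 2) * (1 + \<bar>t\<bar>) powr (- 3 / 2)"
      by (simp add: powr_divide powr_minus_divide)
    finally have "M * norm (Complex \<gamma> t) powr (- 3 / 2) \<le> M * (4 powr (3 / 2) * (1 + \<bar>t\<bar>) powr (- 3 / 2))"
      using M(1) by (intro mult_left_mono) auto
    moreover have "norm (mb_integrand p \<epsilon> (Complex \<gamma> t)) \<le> M * norm (Complex \<gamma> t) powr (- 3 / 2)"
      by (intro M(2)) auto
    ultimately have "norm (mb_integrand p \<epsilon> (Complex \<gamma> t)) \<le> M * (4 powr (3 / 2) * (1 + \<bar>t\<bar>) powr (- 3 / 2))"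
      by linarith
    also have "\<dots> = norm (M * 4 powr (3 / 2) * (1 + \<bar>t\<bar>) powr (- 3 / 2))"
      using M(1) by (simp only: real_norm_def abs_mult) simp
    finally show ?thesis by (simp only: norm_mult norm_ii mult_1_right)
  qed
  then show ?thesis unfolding vertical_integrable_def
    by (intro Bochner_Integration.integrable_bound[OF integrable_mult_right[OF integrable_one_plus_abs_powr] meas] AE_I2) auto
qed

text \<open>With the half-integral abscissa \<open>T = N + 1 / 2\<close> the right side passes between the poles \<open>N\<close> and
  \<open>N + 1\<close>, so the rectangle encloses exactly the poles \<open>1, ..., N\<close>.\<close>
lemma contour_integral_rectpath_mb_integrand:
  assumes p: "0 < p" "p < 1" and \<epsilon>: "0 < \<epsilon>" and \<gamma>: "1 / (2 - p) < \<gamma>" "\<gamma> < 1"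
    and T: "T = real N + 1 / 2" and N: "N > 0"
  shows "contour_integral (rectpath (Complex \<gamma> (- T)) (Complex T T)) (mb_integrand p \<epsilon>)
    = - 2 * of_real pi * \<i> * (\<Sum>n<N. of_real (z_term p \<epsilon> (Suc n)))" (is "contour_integral ?R ?f = _")
    and "continuous_on (path_image (rectpath (Complex \<gamma> (- T)) (Complex T T))) (mb_integrand p \<epsilon>)"
proof -
  define S where "S = {s. Re s > 1 / (2 - p)} \<inter> {s. Re s < real N + 1}"
  define P where "P = (\<lambda>n. of_nat (Suc n) :: complex) ` {..<N}"
  have g0: "1 / (2 - p) > 0" using p by simp
  have S: "open S" "convex S" unfolding S_def
    by (auto intro!: open_Int convex_Int open_halfspace_Re_gt open_halfspace_Re_lt convex_halfspace_Re_gt convex_halfspace_Re_lt)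
  have ints: "s \<in> P" if sS: "s \<in> S" and sZ: "s \<in> \<int>" for s
  proof -
    obtain k :: int where k: "s = of_int k" using sZ by (auto elim: Ints_cases)
    have "1 / (2 - p) < real_of_int k" "k < int N + 1" using sS unfolding S_def k by auto
    moreover from this(1) have "0 < k" using g0 by linarith
    ultimately have "s = of_nat (Suc (nat (k - 1)))" "nat (k - 1) < N" using k by (auto simp: complex_eq_iff)
    then show ?thesis unfolding P_def by blast
  qed
  have holo: "?f holomorphic_on S - P"
  proof (intro mb_integrand_holomorphic p)
    show "(S - P) \<inter> \<int> = {}" using ints by blast
  qed (auto simp: S_def)
  have Tg: "\<gamma> \<le> T" "- T \<le> T" "T < real N + 1" "T > 0" using T N \<gamma> by auto
  have cb: "cbox (Complex \<gamma> (- T)) (Complex T T) \<subseteq> S"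
    using \<gamma> Tg by (auto simp: S_def in_cbox_complex_iff)
  have box: "P \<subseteq> box (Complex \<gamma> (- T)) (Complex T T)"
    using \<gamma> Tg T by (auto simp: P_def in_box_complex_iff)
  have path: "path_image ?R \<subseteq> S - P"
    using path_image_rectpath_subset_cbox[of "Complex \<gamma> (- T)" "Complex T T"]
      path_image_rectpath_inter_box[of "Complex \<gamma> (- T)" "Complex T T"] Tg cb box by auto
  show "continuous_on (path_image ?R) ?f"
    using holomorphic_on_imp_continuous_on[OF holo] path by (rule continuous_on_subset)
  have "contour_integral ?R ?f = 2 * pi * \<i> * (\<Sum>s\<in>P. winding_number ?R s * residue ?f s)"
  proof (rule Residue_theorem[OF S(1) convex_connected[OF S(2)] _ holo _ _ path])
    show "\<forall>s. s \<notin> S \<longrightarrow> winding_number ?R s = 0"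
      using cb Tg by (auto intro!: winding_number_rectpath_outside)
  qed (auto simp: P_def)
  also have "(\<Sum>s\<in>P. winding_number ?R s * residue ?f s) = (\<Sum>s\<in>P. residue ?f s)"
    using box by (intro sum.cong) (auto simp: winding_number_rectpath subset_iff)
  also have "\<dots> = (\<Sum>n<N. residue ?f (of_nat (Suc n)))"
    unfolding P_def by (subst sum.reindex) (auto simp: inj_on_def)
  also have "\<dots> = - (\<Sum>n<N. of_real (z_term p \<epsilon> (Suc n)))"
    unfolding sum_negf[symmetric] by (intro sum.cong refl residue_mb_integrand p \<epsilon>) auto
  finally show "contour_integral ?R ?f = - 2 * of_real pi * \<i> * (\<Sum>n<N. of_real (z_term p \<epsilon> (Suc n)))"
    by simp
qed

text \<open>The difference is the integral over the three remaining sides. Their total length is at most \<open>4 T\<close>, and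
  the integrand is \<open>O(T powr (-3/2))\<close> on them, since they keep distance \<open>T\<close> from the origin.\<close>
lemma truncated_integral_error:
  assumes p: "0 < p" "p < 1" and \<epsilon>: "0 < \<epsilon>" "\<epsilon> \<le> u_star p" and \<gamma>: "1 / (2 - p) < \<gamma>" "\<gamma> < 1"
  obtains M where "\<And>N T. N > 0 \<Longrightarrow> T = real N + 1 / 2 \<Longrightarrow>
     norm (contour_integral (linepath (Complex \<gamma> (- T)) (Complex \<gamma> T)) (mb_integrand p \<epsilon>)
       - 2 * of_real pi * \<i> * (\<Sum>n<N. of_real (z_term p \<epsilon> (Suc n)))) \<le> M * T powr (- 1 / 2)"
proof -
  have \<gamma>0: "\<gamma> > 0" using \<gamma> p by (smt (verit) divide_pos_pos)
  have \<gamma>i: "\<gamma> \<notin> \<int>" using \<gamma>0 \<gamma> by (auto elim!: Ints_cases)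
  obtain M where M: "M > 0"
    "\<And>s. Re s \<ge> \<gamma> \<Longrightarrow> Re s = \<gamma> \<or> (\<exists>n :: nat. Re s = n + 1 / 2) \<or> \<bar>Im s\<bar> \<ge> 1 / 2 \<Longrightarrow>
       norm (mb_integrand p \<epsilon> s) \<le> M * norm s powr (- 3 / 2)"
    using mb_integrand_bound[OF p \<epsilon> \<gamma>(1) \<gamma>i] by blast
  show ?thesis
  proof (rule that[of "4 * M"])
    fix N :: nat and T :: real assume N: "N > 0" and T: "T = real N + 1 / 2"
    let ?f = "mb_integrand p \<epsilon>"
    have T1: "T > 1" using N T by simp
    define a b c d where "a = Complex \<gamma> (- T)" and "b = Complex T T"
      and "c = Complex T (- T)" and "d = Complex \<gamma> T"
    note R = contour_integral_rectpath_mb_integrand[OF p \<epsilon>(1) \<gamma> T N, folded a_def b_def]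
    define J where "J = contour_integral (linepath a c) ?f + contour_integral (linepath c b) ?f
       + contour_integral (linepath b d) ?f"
    have rp: "contour_integral (rectpath a b) ?f = J - contour_integral (linepath a d) ?f"
      unfolding contour_integral_rectpath[OF R(2)] J_def by (simp add: a_def b_def c_def d_def)
    then have err: "contour_integral (linepath a d) ?f - 2 * of_real pi * \<i> * (\<Sum>n<N. of_real (z_term p \<epsilon> (Suc n))) = J"
      unfolding R(1) by (simp add: algebra_simps)
    have sides: "closed_segment a c = {s. Im s = - T \<and> Re s \<in> {\<gamma>..T}}"
      "closed_segment c b = {s. Re s = T \<and> Im s \<in> {- T..T}}"
      "closed_segment b d = {s. Im s = T \<and> Re s \<in> {\<gamma>..T}}"
      using T1 \<gamma> by (simp_all add: a_def b_def c_def d_def closed_segment_same_Im closed_segment_same_Re closed_segment_eq_real_ivl)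
    have bnd: "norm (?f s) \<le> M * T powr (- 3 / 2)"
      if "s \<in> closed_segment a c \<or> s \<in> closed_segment c b \<or> s \<in> closed_segment b d" for s
    proof -
      have "T \<le> norm s"
        using that abs_Re_le_cmod[of s] abs_Im_le_cmod[of s] T1 unfolding sides by auto
      then have "M * norm s powr (- 3 / 2) \<le> M * T powr (- 3 / 2)"
        using M(1) T1 by (intro mult_left_mono powr_mono2') auto
      moreover have "norm (?f s) \<le> M * norm s powr (- 3 / 2)"
      proof (rule M(2))
        show "Re s \<ge> \<gamma>" using that T1 \<gamma> unfolding sides by auto
        have "Re s = real N + 1 / 2 \<or> \<bar>Im s\<bar> \<ge> 1 / 2" using that T1 T unfolding sides by auto
        then show "Re s = \<gamma> \<or> (\<exists>n :: nat. Re s = n + 1 / 2) \<or> \<bar>Im s\<bar> \<ge> 1 / 2" by blast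
      qed
      ultimately show ?thesis by linarith
    qed
    have "path_image (rectpath a b) = closed_segment a c \<union> closed_segment c b \<union> closed_segment b d \<union> closed_segment d a"
      by (simp add: rectpath_def path_image_join Let_def a_def b_def c_def d_def Un_assoc)
    then have cont: "continuous_on (closed_segment a c) ?f" "continuous_on (closed_segment c b) ?f" "continuous_on (closed_segment b d) ?f"
      by (auto intro!: continuous_on_subset[OF R(2)])
    have B0: "0 \<le> M * T powr (- 3 / 2)" using M(1) by simp
    have "norm (contour_integral (linepath a c) ?f) \<le> M * T powr (- 3 / 2) * norm (c - a)"
      "norm (contour_integral (linepath c b) ?f) \<le> M * T powr (- 3 / 2) * norm (b - c)"
      "norm (contour_integral (linepath b d) ?f) \<le> M * T powr (- 3 / 2) * norm (d - b)"
      using cont by (intro contour_integral_bound_linepath contour_integrable_continuous_linepath B0 bnd; blast)+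
    moreover have "norm (c - a) \<le> T" "norm (b - c) \<le> 2 * T" "norm (d - b) \<le> T"
      using T1 \<gamma> \<gamma>0 by (simp_all add: a_def b_def c_def d_def cmod_def real_sqrt_mult)
    ultimately have "norm (contour_integral (linepath a c) ?f) \<le> M * T powr (- 3 / 2) * T"
      "norm (contour_integral (linepath c b) ?f) \<le> M * T powr (- 3 / 2) * (2 * T)"
      "norm (contour_integral (linepath b d) ?f) \<le> M * T powr (- 3 / 2) * T"
      using B0 by (meson mult_left_mono order_trans)+
    then have "norm J \<le> M * T powr (- 3 / 2) * T + M * T powr (- 3 / 2) * (2 * T) + M * T powr (- 3 / 2) * T"
      unfolding J_def by (intro norm_triangle_le add_mono order_trans[OF norm_triangle_ineq]) 
    also have "\<dots> = 4 * M * (T powr (- 3 / 2) * T powr 1)" using T1 by simp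
    also have "T powr (- 3 / 2) * T powr 1 = T powr (- 1 / 2)" unfolding powr_add[symmetric] by simp
    finally show "norm (contour_integral (linepath (Complex \<gamma> (- T)) (Complex \<gamma> T)) ?f
       - 2 * of_real pi * \<i> * (\<Sum>n<N. of_real (z_term p \<epsilon> (Suc n)))) \<le> 4 * M * T powr (- 1 / 2)"
      unfolding err[symmetric, unfolded a_def d_def] .
  qed
qed

theorem theorem5p3:
  fixes p \<epsilon> \<gamma> :: real
  assumes "0 < p" and "p < 1"
    and "0 < \<epsilon>" and "\<epsilon> < u_star p"
    and "1 / (2 - p) < \<gamma>" and "\<gamma> < 1"
  shows "summable (\<lambda>n. z_term p \<epsilon> (Suc n)) \<and>
    vertical_integrable (mb_integrand p \<epsilon>) \<gamma> \<and>
    complex_of_real (z p \<epsilon>) =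
      1 - 1 / (2 * complex_of_real pi * \<i>) * vertical_integral (mb_integrand p \<epsilon>) \<gamma>"
proof (intro conjI)
  have le: "\<epsilon> \<le> u_star p" using assms by simp
  have "\<gamma> > 0" using assms by (smt (verit) divide_pos_pos)
  then have \<gamma>i: "\<gamma> \<notin> \<int>" using assms by (auto elim!: Ints_cases)
  show summ: "summable (\<lambda>n. z_term p \<epsilon> (Suc n))"
    using assms by (intro summable_z_term) auto
  show int: "vertical_integrable (mb_integrand p \<epsilon>) \<gamma>"
    using assms \<gamma>i by (intro vertical_integrable_mb_integrand) auto
  define T where "T N = real (Suc N) + 1 / 2" for N
  define I where "I N = contour_integral (linepath (Complex \<gamma> (- T N)) (Complex \<gamma> (T N))) (mb_integrand p \<epsilon>)" for N
  define Z where "Z N = 2 * of_real pi * \<i> * (\<Sum>n<Suc N. complex_of_real (z_term p \<epsilon> (Suc n)))" for N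
  obtain M where M: "\<And>N. norm (I N - Z N) \<le> M * T N powr (- 1 / 2)"
    using truncated_integral_error[OF assms(1-3) le assms(5,6)] unfolding I_def Z_def T_def
    by (metis zero_less_Suc)
  have "filterlim T at_top sequentially" unfolding T_def by real_asymp
  then have I: "I \<longlonglongrightarrow> vertical_integral (mb_integrand p \<epsilon>) \<gamma>"
    unfolding I_def by (rule vertical_integral_limit[OF int])
  have "(\<lambda>N. M * T N powr (- 1 / 2)) \<longlonglongrightarrow> 0" unfolding T_def by real_asymp
  then have "(\<lambda>N. I N - Z N) \<longlonglongrightarrow> 0"
    by (rule Lim_null_comparison[rotated]) (intro always_eventually allI M)
  from tendsto_diff[OF I this] have "Z \<longlonglongrightarrow> vertical_integral (mb_integrand p \<epsilon>) \<gamma>" by simp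
  moreover have "(\<lambda>n. complex_of_real (z_term p \<epsilon> (Suc n))) sums of_real (\<Sum>n. z_term p \<epsilon> (Suc n))"
    using summ by (intro sums_of_real summable_sums)
  then have "Z \<longlonglongrightarrow> 2 * of_real pi * \<i> * of_real (\<Sum>n. z_term p \<epsilon> (Suc n))"
    unfolding Z_def sums_def by (intro tendsto_intros LIMSEQ_Suc)
  ultimately have "vertical_integral (mb_integrand p \<epsilon>) \<gamma> = 2 * of_real pi * \<i> * of_real (\<Sum>n. z_term p \<epsilon> (Suc n))"
    by (rule LIMSEQ_unique)
  then show "complex_of_real (z p \<epsilon>) =
      1 - 1 / (2 * complex_of_real pi * \<i>) * vertical_integral (mb_integrand p \<epsilon>) \<gamma>"
    by (simp add: z_def)
qed

end
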